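(* Let $\alpha\in(0,1)$, let $S\in\mathcal{C}$, and let $\boldsymbol{\theta}=\arg\min_{\boldsymbol{\beta}\in\mathcal{B}}\mathbb{E}[(S-\boldsymbol{\beta}\cdot\mathbf{Y})^2]$ be the quadratic hedging strategy for $S$. Let $\boldsymbol{\eta}$ be the quantile hedging strategy for the residual risk $S-\boldsymbol{\theta}\cdot\mathbf{Y}$, i.e. $$\boldsymbol{\eta}=\arg\min_{\boldsymbol{\beta}\in\mathcal{B}}\mathbb{E}\left[\ell_\alpha(S-\boldsymbol{\theta}\cdot\mathbf{Y}-\boldsymbol{\beta}\cdot\mathbf{Y})\right],\qquad \ell_\alpha(x)=\frac{\alpha}{1-\alpha}\max(x,0)+\max(-x,0),$$ such that $\mathrm{VaR}_\alpha(S-\boldsymbol{\theta}\cdot\mathbf{Y}-\boldsymbol{\eta}\cdot\mathbf{Y})=0$. Let $\boldsymbol{\nu}$ be the strategy investing only in the risk-free asset, with time-$1$ payoff $\boldsymbol{\nu}\cdot\mathbf{Y}=\mathrm{VaR}_\alpha(S-\boldsymbol{\theta}\cdot\mathbf{Y})$. Then the quantile hedging strategy is the minimiser of the TVaR deviation of the residual risk: $$\mathrm{dTVaR}_\alpha(S-\boldsymbol{\theta}\cdot\mathbf{Y}-\boldsymbol{\eta}\cdot\mathbf{Y})\le \mathrm{dTVaR}_\alpha(S-\boldsymbol{\theta}\cdot\mathbf{Y}-\boldsymbol{\beta}\cdot\mathbf{Y})$$ for all hedging strategies $\boldsymbol{\beta}\in\mathcal{B}$ such that $\mathrm{VaR}_\alpha(S-\boldsymbol{\theta}\cdot\mathbf{Y}-\boldsymbol{\beta}\cdot\mathbf{Y})=0$.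 This is in particular the case for $\boldsymbol{\beta}=\boldsymbol{\nu}$.
   Context: One-period market. $(\Omega,\mathcal{F},\mathbb{P})$ is a probability space and $\mathcal{C}\subseteq L^2(\Omega,\mathcal{F},\mathbb{P})$ is the set of all claims with maturity $1$. There is a risk-free asset (asset $0$) with deterministic interest rate $r\ge 0$ and $n$ risky assets. Asset values at time $0$ are $\mathbf{y}=(1,y_1,\ldots,y_n)$ with $y_i\ge 0$, and at time $1$ they are $\mathbf{Y}=(Y_0,Y_1,\ldots,Y_n)$ with $Y_0=e^r$ and $Y_i\in\mathcal{C}$. The set of trading strategies is $\mathcal{B}=\mathbb{R}^{n+1}$; a strategy $\boldsymbol{\beta}=(\beta_0,\ldots,\beta_n)$ has time-$1$ value $\boldsymbol{\beta}\cdot\mathbf{Y}=\sum_{i=0}^n\beta_i Y_i$. Assets are non-redundant: $\boldsymbol{\beta}\cdot\mathbf{Y}=0$ $\mathbb{P}$-a.s. if and only if $\boldsymbol{\beta}=(0,\ldots,0)$; this ensures that the quadratic hedging problem has a unique solution. For a random variable $X$ with finite mean and $\alpha\in(0,1)$: $$\mathrm{VaR}_\alpha(X)=\inf\{x\in\mathbb{R}:\mathbb{P}(X\le x)\ge\alpha\},\quad \mathrm{TVaR}_\alpha(X)=\frac{1}{1-\alpha}\int_\alpha^1\mathrm{VaR}_u(X)\,du,\quad \mathrm{dTVaR}_\alpha(X)=\mathrm{TVaR}_\alpha(X)-\mathbb{E}[X].$$ *)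

theory Defs
  imports "HOL-Probability.Probability"
begin

text \<open>Random variables are kept as functions on the sample space; they are not identified up to
  almost-sure equality.\<close>

definition L2 :: "'a measure \<Rightarrow> ('a \<Rightarrow> real) set" where
  "L2 M = {X \<in> borel_measurable M. integrable M (\<lambda>\<omega>. (X \<omega>)\<^sup>2)}"

definition VaR :: "'a measure \<Rightarrow> real \<Rightarrow> ('a \<Rightarrow> real) \<Rightarrow> real" where
  "VaR M \<alpha> X = Inf {x. measure M {\<omega> \<in> space M. X \<omega> \<le> x} \<ge> \<alpha>}"

text \<open>The endpoint \<open>u = 1\<close>, where the set in the definition of \<^const>\<open>VaR\<close> may be empty,
  is a null set and is left out of the integral.\<close>

definition TVaR :: "'a measure \<Rightarrow> real \<Rightarrow> ('a \<Rightarrow> real) \<Rightarrow> real" where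
  "TVaR M \<alpha> X = 1 / (1 - \<alpha>) * (LINT u:{\<alpha><..<1}|lborel. VaR M u X)"

definition dTVaR :: "'a measure \<Rightarrow> real \<Rightarrow> ('a \<Rightarrow> real) \<Rightarrow> real" where
  "dTVaR M \<alpha> X = TVaR M \<alpha> X - (LINT \<omega>|M. X \<omega>)"

text \<open>\<open>\<real>\<close>-vectors with index set \<open>{0, \<dots>, n}\<close>, as functions that are \<^const>\<open>undefined\<close> outside it,
  so that equality of strategies is equality of their \<open>n + 1\<close> coordinates.\<close>

definition strategies :: "nat \<Rightarrow> (nat \<Rightarrow> real) set" where
  "strategies n = {0..n} \<rightarrow>\<^sub>E UNIV"

definition payoff :: "nat \<Rightarrow> (nat \<Rightarrow> 'a \<Rightarrow> real) \<Rightarrow> (nat \<Rightarrow> real) \<Rightarrow> 'a \<Rightarrow> real" where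
  "payoff n Y \<beta> \<omega> = (\<Sum>i=0..n. \<beta> i * Y i \<omega>)"

locale one_period_market = prob_space M
  for M :: "'a measure" +
  fixes C :: "('a \<Rightarrow> real) set"
    and r :: real
    and n :: nat
    and y :: "nat \<Rightarrow> real"
    and Y :: "nat \<Rightarrow> 'a \<Rightarrow> real"
  assumes claims: "C \<subseteq> L2 M"
    and rate_nonneg: "r \<ge> 0"
    and riskfree_price: "y 0 = 1"
    and risky_price: "\<And>i. i \<in> {1..n} \<Longrightarrow> y i \<ge> 0"
    and riskfree_value: "Y 0 = (\<lambda>\<omega>. exp r)"
    and risky_value: "\<And>i. i \<in> {1..n} \<Longrightarrow> Y i \<in> C"
    and non_redundant: "\<And>\<beta>. \<beta> \<in> strategies n \<Longrightarrow>
          (AE \<omega> in M. payoff n Y \<beta> \<omega> = 0) \<longleftrightarrow> (\<forall>i\<in>{0..n}. \<beta> i = 0)"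

definition quadratic_hedge ::
    "'a measure \<Rightarrow> nat \<Rightarrow> (nat \<Rightarrow> 'a \<Rightarrow> real) \<Rightarrow> ('a \<Rightarrow> real) \<Rightarrow> (nat \<Rightarrow> real) \<Rightarrow> bool" where
  "quadratic_hedge M n Y X \<theta> \<longleftrightarrow>
     is_arg_min (\<lambda>\<beta>. LINT \<omega>|M. (X \<omega> - payoff n Y \<beta> \<omega>)\<^sup>2) (\<lambda>\<beta>. \<beta> \<in> strategies n) \<theta>"

definition quantile_loss :: "real \<Rightarrow> real \<Rightarrow> real" where
  "quantile_loss \<alpha> x = \<alpha> / (1 - \<alpha>) * max x 0 + max (- x) 0"

text \<open>Minimisers of the expected quantile loss need not be unique; the predicate holds of each
  of them.\<close>

definition quantile_hedge ::
    "'a measure \<Rightarrow> real \<Rightarrow> nat \<Rightarrow> (nat \<Rightarrow> 'a \<Rightarrow> real) \<Rightarrow> ('a \<Rightarrow> real) \<Rightarrow> (nat \<Rightarrow> real) \<Rightarrow> bool" where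
  "quantile_hedge M \<alpha> n Y X \<eta> \<longleftrightarrow>
     is_arg_min (\<lambda>\<beta>. LINT \<omega>|M. quantile_loss \<alpha> (X \<omega> - payoff n Y \<beta> \<omega>))
       (\<lambda>\<beta>. \<beta> \<in> strategies n) \<eta>"

end

theory Submission
  imports Defs
begin

text \<open>When \<open>VaR\<^sub>\<alpha>(X) = 0\<close>, the quantile function of \<open>X\<close> is nonpositive on \<open>(0, \<alpha>]\<close> and nonnegative
  on \<open>(\<alpha>, 1)\<close>. Its integral over \<open>(\<alpha>, 1)\<close> is therefore the integral of its positive part over
  \<open>(0, 1)\<close>, which is \<open>E[max(X, 0)]\<close> since the quantile function has the law of \<open>X\<close> under the uniform
  distribution. As \<open>\<alpha> / (1 - \<alpha>) + 1 = 1 / (1 - \<alpha>)\<close>, this turns \<open>dTVaR\<^sub>\<alpha>(X)\<close> into the expected quantile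
  loss of \<open>X\<close>, which the quantile hedge minimises.\<close>

context prob_space
begin

text \<open>This puts \<open>VaR\<close> in the form of the pseudo-inverse \<open>I\<close> of the
  locale \<open>cdf_distribution\<close>, whose facts then apply.\<close>

lemma VaR_eq_Inf_cdf:
  assumes [measurable]: "random_variable borel X"
  shows "VaR M u X = Inf {x. u \<le> cdf (distr M borel X) x}"
proof -
  have "X -` {..x} \<inter> space M = {\<omega> \<in> space M. X \<omega> \<le> x}" for x
    by auto
  then show ?thesis
    unfolding VaR_def cdf_def by (simp add: measure_distr)
qed

text \<open>Galois connection between quantile function and cdf: right-continuity of the cdf makes
  the infimum attained, and \<open>0 < u < 1\<close> makes the set nonempty and bounded
  below.\<close>

lemma VaR_le_iff:
  assumes [measurable]: "random_variable borel X" and "0 < u" "u < 1"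
  shows "VaR M u X \<le> x \<longleftrightarrow> u \<le> measure M {\<omega> \<in> space M. X \<omega> \<le> x}"
proof -
  interpret D: cdf_distribution "distr M borel X"
    unfolding cdf_distribution_def by (rule real_distribution_distr) measurable
  have "cdf (distr M borel X) x = measure M {\<omega> \<in> space M. X \<omega> \<le> x}"
    unfolding cdf_def by (simp add: measure_distr vimage_def Int_def conj_commute)
  then show ?thesis
    using D.pseudoinverse[OF assms(2,3), of x] VaR_eq_Inf_cdf[OF assms(1)] by simp
qed

lemma VaR_mono_level:
  assumes "random_variable borel X" and "0 < u" "u \<le> v" "v < 1"
  shows "VaR M u X \<le> VaR M v X"
proof -
  have "v \<le> measure M {\<omega> \<in> space M. X \<omega> \<le> VaR M v X}"
    using assms by (intro VaR_le_iff[THEN iffD1]) auto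
  then show ?thesis
    using assms by (intro VaR_le_iff[THEN iffD2]) auto
qed

lemma VaR_diff_const:
  assumes [measurable]: "random_variable borel X" and "0 < u" "u < 1"
    and Z: "\<And>\<omega>. \<omega> \<in> space M \<Longrightarrow> Z \<omega> = X \<omega> - c"
  shows "VaR M u Z = VaR M u X - c"
proof -
  have meas_Z: "random_variable borel Z"
    by (subst measurable_cong[OF Z]) measurable
  have "{\<omega> \<in> space M. Z \<omega> \<le> x} = {\<omega> \<in> space M. X \<omega> \<le> x + c}" for x
    using Z by (intro Collect_cong) (auto simp: le_diff_eq diff_le_eq)
  then have "VaR M u Z \<le> x \<longleftrightarrow> VaR M u X - c \<le> x" for x
    using VaR_le_iff[OF meas_Z assms(2,3), of x] VaR_le_iff[OF assms(1-3), of "x + c"]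
    by (simp add: algebra_simps)
  then show ?thesis
    \<comment> \<open>Two reals with the same upper bounds are equal.\<close>
    by (meson order_antisym order_refl)
qed

text \<open>Quantile transform: under the uniform law on (0, 1), \<open>VaR M u X\<close> as a
  function of \<open>u\<close> has the law of \<open>X\<close>. Integrability of \<open>g\<close> is
  not assumed, since change of variables for the Bochner integral asks only for
  measurability.\<close>

lemma integral_VaR:
  fixes g :: "real \<Rightarrow> real"
  assumes [measurable]: "random_variable borel X" "g \<in> borel_measurable borel"
  shows "(LINT u:{0<..<1}|lborel. g (VaR M u X)) = expectation (\<lambda>\<omega>. g (X \<omega>))"
proof -
  let ?D = "distr M borel X" and ?U = "restrict_space lborel {0<..<1::real}"
  interpret D: cdf_distribution ?D
    unfolding cdf_distribution_def by (rule real_distribution_distr) measurable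
  have I: "VaR M u X = D.I u" for u
    by (rule VaR_eq_Inf_cdf) measurable
  \<comment> \<open>\<open>D.measurable_CI\<close> speaks of the restriction of
    \<open>borel\<close>; that of \<open>lborel\<close> has the same measurable sets.\<close>
  have [measurable]: "D.I \<in> ?U \<rightarrow>\<^sub>M borel"
    using D.measurable_CI
    by (subst measurable_cong_sets[where M' = "restrict_space borel {0<..<1}" and N' = borel])
      (auto intro!: sets_restrict_space_cong)
  have "(LINT u:{0<..<1}|lborel. g (VaR M u X)) = (LINT u|?U. g (D.I u))"
    unfolding I by (subst integral_restrict_space) (auto simp: set_lebesgue_integral_def)
  also have "\<dots> = (LINT x|distr ?U borel D.I. g x)"
    by (rule integral_distr[symmetric]) measurable
  also have "\<dots> = (LINT x|?D. g x)"
    by (simp only: D.distr_I_eq_M)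
  also have "\<dots> = expectation (\<lambda>\<omega>. g (X \<omega>))"
    by (rule integral_distr) measurable
  finally show ?thesis .
qed

lemma TVaR_eq_expectation_pos_part:
  assumes X: "random_variable borel X" and a: "0 < \<alpha>" "\<alpha> < 1" and V: "VaR M \<alpha> X = 0"
  shows "TVaR M \<alpha> X = 1 / (1 - \<alpha>) * expectation (\<lambda>\<omega>. max (X \<omega>) 0)"
proof -
  have "indicator {\<alpha><..<1} u *\<^sub>R VaR M u X = indicator {0<..<1} u *\<^sub>R max (VaR M u X) 0" for u
    using VaR_mono_level[OF X, of \<alpha> u] VaR_mono_level[OF X, of u \<alpha>] a V
    by (cases "u \<le> \<alpha>") (auto simp: indicator_def max_def)
  then have "(LINT u:{\<alpha><..<1}|lborel. VaR M u X) = (LINT u:{0<..<1}|lborel. max (VaR M u X) 0)"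
    unfolding set_lebesgue_integral_def by simp
  then show ?thesis
    unfolding TVaR_def using integral_VaR[OF X, of "\<lambda>x. max x 0"] by simp
qed

lemma expectation_quantile_loss_eq_dTVaR:
  assumes X: "integrable M X" and a: "0 < \<alpha>" "\<alpha> < 1" and V: "VaR M \<alpha> X = 0"
  shows "expectation (\<lambda>\<omega>. quantile_loss \<alpha> (X \<omega>)) = dTVaR M \<alpha> X"
proof -
  have "\<alpha> / (1 - \<alpha>) = 1 / (1 - \<alpha>) - 1"
    using a by (simp add: divide_simps)
  \<comment> \<open>From \<open>max (- x) 0 = max x 0 - x\<close>; the summand \<open>- x\<close>
    supplies the expectation subtracted in \<open>dTVaR\<close>.\<close>
  then have "quantile_loss \<alpha> x = 1 / (1 - \<alpha>) * max x 0 - x" for x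
    unfolding quantile_loss_def by (simp add: max_def left_diff_distrib)
  then have "expectation (\<lambda>\<omega>. quantile_loss \<alpha> (X \<omega>))
      = expectation (\<lambda>\<omega>. 1 / (1 - \<alpha>) * max (X \<omega>) 0 - X \<omega>)"
    by (simp only:)
  also have "\<dots> = expectation (\<lambda>\<omega>. 1 / (1 - \<alpha>) * max (X \<omega>) 0) - expectation X"
    using X by (intro Bochner_Integration.integral_diff integrable_mult_right integrable_max) auto
  also have "\<dots> = dTVaR M \<alpha> X"
    unfolding dTVaR_def TVaR_eq_expectation_pos_part[OF borel_measurable_integrable[OF X] a V]
    by (simp only: integral_mult_right_zero)
  finally show ?thesis .
qed

lemma L2_imp_integrable:
  assumes "X \<in> L2 M"
  shows "integrable M X"
  using assms unfolding L2_def by (blast intro: square_integrable_imp_integrable[where f = X])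

end

context one_period_market
begin

lemma integrable_claim: "X \<in> C \<Longrightarrow> integrable M X"
  by (rule L2_imp_integrable) (rule subsetD[OF claims])

lemma integrable_payoff: "integrable M (payoff n Y \<beta>)"
proof -
  have "integrable M (Y i)" if "i \<in> {0..n}" for i
    \<comment> \<open>Asset 0 is treated apart: its value is a constant, and only the risky values
      are assumed to lie in \<open>C\<close>.\<close>
    using that riskfree_value integrable_claim[OF risky_value, of i] by (cases "i = 0") auto
  then show ?thesis
    unfolding payoff_def[abs_def] by (intro Bochner_Integration.integrable_sum integrable_mult_right) auto
qed

end

theorem lemma2p8:
  fixes M :: "'a measure"
    and C :: "('a \<Rightarrow> real) set"
    and r \<alpha> :: real
    and n :: nat
    and y \<theta> \<eta> \<nu> :: "nat \<Rightarrow> real"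
    and Y :: "nat \<Rightarrow> 'a \<Rightarrow> real"
    and S :: "'a \<Rightarrow> real"
  assumes "one_period_market M C r n y Y"
    and "\<alpha> \<in> {0<..<1}"
    and "S \<in> C"
    and "quadratic_hedge M n Y S \<theta>"
    and "quantile_hedge M \<alpha> n Y (\<lambda>\<omega>. S \<omega> - payoff n Y \<theta> \<omega>) \<eta>"
    and "VaR M \<alpha> (\<lambda>\<omega>. S \<omega> - payoff n Y \<theta> \<omega> - payoff n Y \<eta> \<omega>) = 0"
    and "\<nu> \<in> strategies n"
    and "\<forall>i\<in>{1..n}. \<nu> i = 0"
    and "\<forall>\<omega>\<in>space M. payoff n Y \<nu> \<omega> = VaR M \<alpha> (\<lambda>\<omega>'. S \<omega>' - payoff n Y \<theta> \<omega>')"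
  shows "(\<forall>\<beta>\<in>strategies n.
            VaR M \<alpha> (\<lambda>\<omega>. S \<omega> - payoff n Y \<theta> \<omega> - payoff n Y \<beta> \<omega>) = 0 \<longrightarrow>
            dTVaR M \<alpha> (\<lambda>\<omega>. S \<omega> - payoff n Y \<theta> \<omega> - payoff n Y \<eta> \<omega>)
              \<le> dTVaR M \<alpha> (\<lambda>\<omega>. S \<omega> - payoff n Y \<theta> \<omega> - payoff n Y \<beta> \<omega>)) \<and>
         VaR M \<alpha> (\<lambda>\<omega>. S \<omega> - payoff n Y \<theta> \<omega> - payoff n Y \<nu> \<omega>) = 0 \<and>
         dTVaR M \<alpha> (\<lambda>\<omega>. S \<omega> - payoff n Y \<theta> \<omega> - payoff n Y \<eta> \<omega>)
           \<le> dTVaR M \<alpha> (\<lambda>\<omega>. S \<omega> - payoff n Y \<theta> \<omega> - payoff n Y \<nu> \<omega>)"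
proof -
  interpret one_period_market M C r n y Y
    by fact
  let ?R = "\<lambda>\<omega>. S \<omega> - payoff n Y \<theta> \<omega>"
  let ?Z = "\<lambda>\<beta> \<omega>. S \<omega> - payoff n Y \<theta> \<omega> - payoff n Y \<beta> \<omega>"
  have a: "0 < \<alpha>" "\<alpha> < 1"
    using assms(2) by auto
  have R: "integrable M ?R"
    using integrable_claim[OF assms(3)] integrable_payoff by auto
  have Z: "integrable M (?Z \<beta>)" for \<beta>
    using R integrable_payoff by auto
  have minimal: "dTVaR M \<alpha> (?Z \<eta>) \<le> dTVaR M \<alpha> (?Z \<beta>)"
    if "\<beta> \<in> strategies n" "VaR M \<alpha> (?Z \<beta>) = 0" for \<beta>
  proof -
    \<comment> \<open>Optimality of \<open>\<eta>\<close> holds against every strategy; the VaR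
      constraint on \<open>\<beta>\<close> serves to read the right-hand side as a
      \<open>dTVaR\<close>.\<close>
    have "expectation (\<lambda>\<omega>. quantile_loss \<alpha> (?Z \<eta> \<omega>)) \<le> expectation (\<lambda>\<omega>. quantile_loss \<alpha> (?Z \<beta> \<omega>))"
      using assms(5) that(1) by (auto simp: quantile_hedge_def is_arg_min_def not_less)
    then show ?thesis
      using expectation_quantile_loss_eq_dTVaR[OF Z a assms(6)]
        expectation_quantile_loss_eq_dTVaR[OF Z a that(2)] by simp
  qed
  \<comment> \<open>On \<open>space M\<close>, \<open>\<nu>\<close> pays the constant
    \<open>VaR M \<alpha> ?R\<close>, so translation makes \<open>\<nu>\<close> an admissible
    competitor.\<close>
  have "VaR M \<alpha> (?Z \<nu>) = VaR M \<alpha> ?R - VaR M \<alpha> ?R"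
    using assms(9) by (intro VaR_diff_const[OF borel_measurable_integrable[OF R] a]) auto
  then have "VaR M \<alpha> (?Z \<nu>) = 0"
    by simp
  then show ?thesis
    using minimal assms(7) by blast
qed

end
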